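(* For every normalized binary goods instance with laminar approval sets, with an arbitrary number of agents, there exists a randomized allocation that is ex-ante EF, ex-ante EQ, and ex-post both EF1 and EQ1, and such a randomized allocation can be computed in polynomial time.
   Context: An instance consists of agents $N=\{1,\dots,n\}$, a finite set $M$ of indivisible items, and for each agent $i$ an additive valuation $v_i:2^M\to\mathbb{R}$, i.e. $v_i(\emptyset)=0$ and $v_i(S)=\sum_{o\in S}v_i(o)$. It is a binary goods instance if $v_i(o)\in\{0,1\}$ for all $i,o$. It is normalized if $v_i(M)=v_j(M)$ for all $i,j\in N$. The approval set of agent $i$ is $\Gamma_i=\{g\in M: v_i(g)=1\}$; the approval sets are laminar if any two of them are disjoint or one contains the other. An allocation $A=(A_1,\dots,A_n)$ is a partition of $M$ into $n$ pairwise disjoint, possibly empty bundles with union $M$. For goods: $A$ is EF1 if for all $i,j\in N$ with $A_j\neq\emptyset$ there is $g\in A_j$ with $v_i(A_i)\ge v_i(A_j\setminus\{g\})$. $A$ is EQ1 if for all $i,j\in N$ with $A_j\neq\emptyset$ there is $g\in A_j$ with $v_i(A_i)\ge v_j(A_j\setminus\{g\})$. A randomized allocation is a probability distribution over deterministic allocations $A^{(1)},\dots,A^{(k)}$ with probabilities $p_1,\dots,p_k\in[0,1]$, $\sum_\ell p_\ell=1$. It is ex-ante EQ if $\sum_\ell p_\ell v_i(A_i^{(\ell)})=\sum_\ell p_\ell v_j(A_j^{(\ell)})$ for all $i,j\in N$, and ex-ante EF if $\sum_\ell p_\ell v_i(A_i^{(\ell)})\ge\sum_\ell p_\ell v_i(A_j^{(\ell)})$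 for all $i,j\in N$. It satisfies a property ex-post if every allocation in its support satisfies that property. Computing a randomized allocation means outputting the list of support allocations with their probabilities. *)

theory Defs
  imports
    "HOL-Probability.Probability"
    "HOL-Computational_Algebra.Polynomial"
begin

section \<open>Fair division instances\<close>

text \<open>
  Agents are the numbers \<open>1, \<dots>, n\<close>. A valuation profile \<open>v\<close> assigns to every agent a set
  function; the value of a single item \<open>g\<close> is \<open>v i {g}\<close>.
\<close>

definition additive_valuation :: "'a set \<Rightarrow> ('a set \<Rightarrow> real) \<Rightarrow> bool" where
  "additive_valuation M f \<longleftrightarrow> f {} = 0 \<and> (\<forall>S\<subseteq>M. f S = (\<Sum>g\<in>S. f {g}))"

definition fair_division_instance :: "nat \<Rightarrow> 'a set \<Rightarrow> (nat \<Rightarrow> 'a set \<Rightarrow> real) \<Rightarrow> bool" where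
  "fair_division_instance n M v \<longleftrightarrow>
     1 \<le> n \<and> finite M \<and> (\<forall>i\<in>{1..n}. additive_valuation M (v i))"

definition binary_goods :: "nat \<Rightarrow> 'a set \<Rightarrow> (nat \<Rightarrow> 'a set \<Rightarrow> real) \<Rightarrow> bool" where
  "binary_goods n M v \<longleftrightarrow> (\<forall>i\<in>{1..n}. \<forall>g\<in>M. v i {g} \<in> {0, 1})"

definition normalized :: "nat \<Rightarrow> 'a set \<Rightarrow> (nat \<Rightarrow> 'a set \<Rightarrow> real) \<Rightarrow> bool" where
  "normalized n M v \<longleftrightarrow> (\<forall>i\<in>{1..n}. \<forall>j\<in>{1..n}. v i M = v j M)"

definition approval_set :: "'a set \<Rightarrow> (nat \<Rightarrow> 'a set \<Rightarrow> real) \<Rightarrow> nat \<Rightarrow> 'a set" where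
  "approval_set M v i = {g \<in> M. v i {g} = 1}"

definition laminar_approvals :: "nat \<Rightarrow> 'a set \<Rightarrow> (nat \<Rightarrow> 'a set \<Rightarrow> real) \<Rightarrow> bool" where
  "laminar_approvals n M v \<longleftrightarrow>
     (\<forall>i\<in>{1..n}. \<forall>j\<in>{1..n}.
        approval_set M v i \<inter> approval_set M v j = {} \<or>
        approval_set M v i \<subseteq> approval_set M v j \<or>
        approval_set M v j \<subseteq> approval_set M v i)"


section \<open>Allocations\<close>

text \<open>
  The tuple \<open>(A 1, \<dots>, A n)\<close> is an extensional function on \<open>{1..n}\<close>, so that equal tuples are
  equal functions and a distribution over allocations has the intended support.
\<close>

definition allocation :: "nat \<Rightarrow> 'a set \<Rightarrow> (nat \<Rightarrow> 'a set) \<Rightarrow> bool" where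
  "allocation n M A \<longleftrightarrow>
     A \<in> {1..n} \<rightarrow>\<^sub>E Pow M \<and> disjoint_family_on A {1..n} \<and> (\<Union>i\<in>{1..n}. A i) = M"

definition EF1 :: "nat \<Rightarrow> (nat \<Rightarrow> 'a set \<Rightarrow> real) \<Rightarrow> (nat \<Rightarrow> 'a set) \<Rightarrow> bool" where
  "EF1 n v A \<longleftrightarrow>
     (\<forall>i\<in>{1..n}. \<forall>j\<in>{1..n}. A j \<noteq> {} \<longrightarrow> (\<exists>g\<in>A j. v i (A i) \<ge> v i (A j - {g})))"

definition EQ1 :: "nat \<Rightarrow> (nat \<Rightarrow> 'a set \<Rightarrow> real) \<Rightarrow> (nat \<Rightarrow> 'a set) \<Rightarrow> bool" where
  "EQ1 n v A \<longleftrightarrow>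
     (\<forall>i\<in>{1..n}. \<forall>j\<in>{1..n}. A j \<noteq> {} \<longrightarrow> (\<exists>g\<in>A j. v i (A i) \<ge> v j (A j - {g})))"

definition randomized_allocation :: "nat \<Rightarrow> 'a set \<Rightarrow> (nat \<Rightarrow> 'a set) pmf \<Rightarrow> bool" where
  "randomized_allocation n M D \<longleftrightarrow>
     finite (set_pmf D) \<and> (\<forall>A\<in>set_pmf D. allocation n M A)"

definition ex_ante_EQ :: "nat \<Rightarrow> (nat \<Rightarrow> 'a set \<Rightarrow> real) \<Rightarrow> (nat \<Rightarrow> 'a set) pmf \<Rightarrow> bool" where
  "ex_ante_EQ n v D \<longleftrightarrow>
     (\<forall>i\<in>{1..n}. \<forall>j\<in>{1..n}.
        measure_pmf.expectation D (\<lambda>A. v i (A i)) = measure_pmf.expectation D (\<lambda>A. v j (A j)))"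

definition ex_ante_EF :: "nat \<Rightarrow> (nat \<Rightarrow> 'a set \<Rightarrow> real) \<Rightarrow> (nat \<Rightarrow> 'a set) pmf \<Rightarrow> bool" where
  "ex_ante_EF n v D \<longleftrightarrow>
     (\<forall>i\<in>{1..n}. \<forall>j\<in>{1..n}.
        measure_pmf.expectation D (\<lambda>A. v i (A i)) \<ge> measure_pmf.expectation D (\<lambda>A. v i (A j)))"

definition ex_post :: "((nat \<Rightarrow> 'a set) \<Rightarrow> bool) \<Rightarrow> (nat \<Rightarrow> 'a set) pmf \<Rightarrow> bool" where
  "ex_post P D \<longleftrightarrow> (\<forall>A\<in>set_pmf D. P A)"


section \<open>Polynomial-time computation\<close>

text \<open>
  The machine model is a random access machine with registers, an indirectly addressed memory and
  a write-only output list, programmed by while programs. Cells hold natural numbers, and the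
  arithmetic operations are addition and truncated subtraction only. Each operation costs one unit.
  Since there is no multiplication, one operation lengthens the largest number present by at most
  one bit, so \<open>t\<close> steps only involve numbers of \<open>O(t + log s)\<close> bits, where \<open>s\<close> bounds the input
  length and the program constants; hence unit-cost polynomial time on this machine coincides with
  polynomial time on Turing machines.
\<close>

datatype expr =
    Const nat
  | Reg nat
  | Mem expr
  | Plus expr expr
  | Minus expr expr

datatype prog =
    Skip
  | Assign nat expr
  | Store expr expr
  | Write expr
  | Seq prog prog
  | If expr prog prog
  | While expr prog

record mstate =
  regs :: "nat \<Rightarrow> nat"
  mem :: "nat \<Rightarrow> nat"
  outp :: "nat list"

primrec eval_expr :: "expr \<Rightarrow> mstate \<Rightarrow> nat" where
  "eval_expr (Const k) s = k"
| "eval_expr (Reg r) s = regs s r"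
| "eval_expr (Mem e) s = mem s (eval_expr e s)"
| "eval_expr (Plus d e) s = eval_expr d s + eval_expr e s"
| "eval_expr (Minus d e) s = eval_expr d s - eval_expr e s"

primrec cost_expr :: "expr \<Rightarrow> nat" where
  "cost_expr (Const k) = 1"
| "cost_expr (Reg r) = 1"
| "cost_expr (Mem e) = cost_expr e + 1"
| "cost_expr (Plus d e) = cost_expr d + cost_expr e + 1"
| "cost_expr (Minus d e) = cost_expr d + cost_expr e + 1"

text \<open>
  \<open>exec c s t s'\<close>: program \<open>c\<close> started in \<open>s\<close> halts in \<open>s'\<close> after \<open>t\<close> steps. In \<open>Store d e\<close> the
  first argument is the address. Tests succeed on nonzero values.
\<close>

inductive exec :: "prog \<Rightarrow> mstate \<Rightarrow> nat \<Rightarrow> mstate \<Rightarrow> bool" where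
  Skip: "exec Skip s 1 s"
| Assign: "exec (Assign r e) s (cost_expr e + 1) (s\<lparr>regs := (regs s)(r := eval_expr e s)\<rparr>)"
| Store: "exec (Store d e) s (cost_expr d + cost_expr e + 1)
            (s\<lparr>mem := (mem s)(eval_expr d s := eval_expr e s)\<rparr>)"
| Write: "exec (Write e) s (cost_expr e + 1) (s\<lparr>outp := outp s @ [eval_expr e s]\<rparr>)"
| Seq: "exec c s t s' \<Longrightarrow> exec d s' t' s'' \<Longrightarrow> exec (Seq c d) s (t + t') s''"
| IfTrue: "eval_expr b s \<noteq> 0 \<Longrightarrow> exec c s t s' \<Longrightarrow> exec (If b c d) s (cost_expr b + 1 + t) s'"
| IfFalse: "eval_expr b s = 0 \<Longrightarrow> exec d s t s' \<Longrightarrow> exec (If b c d) s (cost_expr b + 1 + t) s'"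
| WhileFalse: "eval_expr b s = 0 \<Longrightarrow> exec (While b c) s (cost_expr b + 1) s"
| WhileTrue: "eval_expr b s \<noteq> 0 \<Longrightarrow> exec c s t s' \<Longrightarrow> exec (While b c) s' t' s'' \<Longrightarrow>
                exec (While b c) s (cost_expr b + 1 + t + t') s''"

inductive_cases SkipE: "exec Skip s t s'"
inductive_cases AssignE: "exec (Assign r e) s t s'"
inductive_cases StoreE: "exec (Store d e) s t s'"
inductive_cases WriteE: "exec (Write e) s t s'"
inductive_cases SeqE: "exec (Seq c d) s t s'"
inductive_cases IfE: "exec (If b c d) s t s'"
inductive_cases WhileE: "exec (While b c) s t s'"

lemma exec_deterministic:
  "exec c s t s' \<Longrightarrow> exec c s u r \<Longrightarrow> t = u \<and> s' = r"
proof (induction arbitrary: u r rule: exec.induct)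
  case (Seq c s t s' d t' s'')
  from Seq.prems obtain t1 s1 t2 where *: "exec c s t1 s1" "exec d s1 t2 r" "u = t1 + t2"
    by (rule SeqE)
  with Seq.IH(1)[OF *(1)] Seq.IH(2)[of t2 r] show ?case by simp
next
  case (IfTrue b s c t s' d)
  from IfTrue.prems obtain t1 where *: "exec c s t1 r" "u = cost_expr b + 1 + t1"
    by (rule IfE) (simp_all add: IfTrue.hyps)
  with IfTrue.IH[OF *(1)] show ?case by simp
next
  case (IfFalse b s d t s' c)
  from IfFalse.prems obtain t1 where *: "exec d s t1 r" "u = cost_expr b + 1 + t1"
    by (rule IfE) (simp_all add: IfFalse.hyps)
  with IfFalse.IH[OF *(1)] show ?case by simp
next
  case (WhileFalse b s c)
  from WhileFalse.prems show ?case
    by (rule WhileE) (simp_all add: WhileFalse.hyps)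
next
  case (WhileTrue b s c t s' t' s'')
  from WhileTrue.prems obtain t1 s1 t2
    where *: "exec c s t1 s1" "exec (While b c) s1 t2 r" "u = cost_expr b + 1 + t1 + t2"
    by (rule WhileE) (simp_all add: WhileTrue.hyps)
  with WhileTrue.IH(1)[OF *(1)] WhileTrue.IH(2)[of t2 r] show ?case by simp
qed (auto elim: SkipE AssignE StoreE WriteE)

text \<open>The input is a bit string: its length is in register 0, its bits in the first memory cells.\<close>

definition initial_state :: "bool list \<Rightarrow> mstate" where
  "initial_state w =
     \<lparr> regs = (\<lambda>r. if r = 0 then length w else 0),
       mem = (\<lambda>a. if a < length w then of_bool (w ! a) else 0),
       outp = [] \<rparr>"

definition poly_time_solvable ::
    "'x set \<Rightarrow> ('x \<Rightarrow> bool list) \<Rightarrow> ('x \<Rightarrow> nat list \<Rightarrow> bool) \<Rightarrow> bool" where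
  "poly_time_solvable X enc R \<longleftrightarrow>
     (\<exists>(c :: prog) (p :: nat poly). \<forall>x\<in>X. \<exists>t s.
        exec c (initial_state (enc x)) t s \<and> t \<le> poly p (length (enc x)) \<and> R x (outp s))"


section \<open>Input and output encodings\<close>

text \<open>
  For computations the items are \<open>1, \<dots>, m\<close>. A binary instance is presented as \<open>n\<close> and \<open>m\<close> in
  unary, followed by the rows of its approval matrix.
\<close>

definition encode_instance :: "nat \<Rightarrow> nat \<Rightarrow> (nat \<Rightarrow> nat set \<Rightarrow> real) \<Rightarrow> bool list" where
  "encode_instance n m v =
     replicate n True @ [False] @ replicate m True @ [False] @
     concat (map (\<lambda>i. map (\<lambda>g. v i {g} = 1) [1..<Suc m]) [1..<Suc n])"

text \<open>The allocation in which item \<open>g\<close> is given to the agent \<open>ow ! (g - 1)\<close>.\<close>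

definition allocation_of_owners :: "nat \<Rightarrow> nat \<Rightarrow> nat list \<Rightarrow> nat \<Rightarrow> nat set" where
  "allocation_of_owners n m ow = (\<lambda>i\<in>{1..n}. {g \<in> {1..m}. ow ! (g - 1) = i})"

text \<open>
  The output lists every support allocation exactly once, as a block of \<open>m + 2\<close> numbers
  \<open>a, b, ow ! 0, \<dots>, ow ! (m - 1)\<close> that gives its probability \<open>a / b\<close> and its owners.
\<close>

definition encodes_distribution ::
    "nat \<Rightarrow> nat \<Rightarrow> nat list \<Rightarrow> (nat \<Rightarrow> nat set) pmf \<Rightarrow> bool" where
  "encodes_distribution n m w D \<longleftrightarrow>
     (\<exists>L :: (nat \<times> nat \<times> nat list) list.
        w = concat (map (\<lambda>(a, b, ow). a # b # ow) L) \<and>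
        distinct (map (\<lambda>(a, b, ow). ow) L) \<and>
        (\<forall>(a, b, ow)\<in>set L.
           length ow = m \<and> set ow \<subseteq> {1..n} \<and> 0 < b \<and>
           pmf D (allocation_of_owners n m ow) = real a / real b) \<and>
        (\<lambda>(a, b, ow). allocation_of_owners n m ow) ` set L = set_pmf D)"

end

theory Submission
  imports Defs
begin

text \<open>
  Normalized binary valuations have approval sets of equal size, so in a laminar instance any two
  approval sets are equal or disjoint. Number the items inside each approval set consecutively and,
  for a uniformly random \<open>r < n\<close>, give the item with number \<open>x\<close> to agent \<open>(x + r) mod n + 1\<close>.
  Every agent then receives every item with probability \<open>1 / n\<close>, which gives ex-ante EF and EQ.
  In each outcome any two shares of one approval set differ in size by at most one, and the sizes
  depend only on the common size of the approval sets, which gives EF1 and EQ1.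
\<close>

section \<open>Residues and ranks\<close>

text \<open>The shift by \<open>r\<close> is undone modulo \<open>n\<close> by the shift by
  \<open>n - r\<close>. Moving it from \<open>x\<close> to \<open>a\<close> turns counts of shifted
  residues into counts of plain ones.\<close>

lemma add_mod_eq_iff:
  fixes n :: nat
  assumes "r < n" "a < n"
  shows "(x + r) mod n = a \<longleftrightarrow> x mod n = (a + (n - r)) mod n"
proof
  assume "(x + r) mod n = a"
  then have "(a + (n - r)) mod n = (x + r + (n - r)) mod n"
    by (metis mod_add_left_eq)
  then show "x mod n = (a + (n - r)) mod n" using assms by simp
next
  assume "x mod n = (a + (n - r)) mod n"
  then have "(x + r) mod n = (a + (n - r) + r) mod n"
    by (metis mod_add_left_eq)
  then show "(x + r) mod n = a" using assms by simp
qed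

text \<open>For fixed \<open>x\<close>, the map from \<open>r\<close> to
  \<open>(x + r) mod n\<close> permutes the residues. Hence exactly one of the \<open>n\<close>
  rotations gives a fixed item to a fixed agent.\<close>

lemma card_add_mod_eq:
  fixes n :: nat
  assumes "a < n"
  shows "card {r\<in>{..<n}. (x + r) mod n = a} = 1"
proof -
  \<comment> \<open>The roles are exchanged: \<open>r\<close> is the unknown and
    \<open>x mod n\<close> is the shift.\<close>
  have "(x + r) mod n = a \<longleftrightarrow> r = (a + (n - x mod n)) mod n" if "r < n" for r
    using add_mod_eq_iff[of "x mod n" n a r] assms that
    by (simp add: mod_add_left_eq add.commute[of r])
  then have "{r\<in>{..<n}. (x + r) mod n = a} = {(a + (n - x mod n)) mod n}"
    using assms by auto
  then show ?thesis by simp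
qed

text \<open>Below \<open>k\<close> lie \<open>k div n\<close> full periods and a remainder that
  meets exactly the residues smaller than \<open>k mod n\<close> once more.\<close>

lemma card_residue:
  fixes n :: nat
  assumes "a < n"
  shows "card {x\<in>{..<k}. x mod n = a} = k div n + of_bool (a < k mod n)"
proof (induction k)
  case (Suc k)
  have "{x\<in>{..<Suc k}. x mod n = a} =
      (if k mod n = a then insert k {x\<in>{..<k}. x mod n = a} else {x\<in>{..<k}. x mod n = a})"
    by (auto simp: less_Suc_eq)
  then have "card {x\<in>{..<Suc k}. x mod n = a} =
      k div n + of_bool (a < k mod n) + of_bool (k mod n = a)"
    using Suc by simp
  moreover have "k mod n < n" using assms by simp
  ultimately show ?case using assms by (auto simp: div_Suc mod_Suc)
qed simp

text \<open>Once the shift is moved away, \<open>card_residue\<close> gives both counts as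
  \<open>k div n\<close> plus 0 or 1.\<close>

lemma card_shifted_residue_le:
  fixes n :: nat
  assumes "r < n" "a < n" "b < n"
  shows "card {x\<in>{..<k}. (x + r) mod n = a} \<le> Suc (card {x\<in>{..<k}. (x + r) mod n = b})"
  using assms card_residue[of "(a + (n - r)) mod n" n k] card_residue[of "(b + (n - r)) mod n" n k]
  by (simp add: add_mod_eq_iff)

text \<open>The rank grows strictly with \<open>f\<close>, so it is injective, and it stays below
  \<open>card S\<close> because no element precedes itself. Equal cardinalities then give
  surjectivity.\<close>

lemma bij_betw_rank:
  fixes f :: "'a \<Rightarrow> nat"
  assumes "finite S" "inj_on f S"
  shows "bij_betw (\<lambda>g. card {h\<in>S. f h < f g}) S {..<card S}"
proof -
  let ?rk = "\<lambda>g. card {h\<in>S. f h < f g}"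
  have mono: "?rk g < ?rk g'" if "g \<in> S" "g' \<in> S" "f g < f g'" for g g'
    using that assms(1) by (intro psubset_card_mono) auto
  then have inj: "inj_on ?rk S"
    using assms(2) by (metis (mono_tags, lifting) inj_on_def less_irrefl nat_neq_iff)
  moreover have "?rk ` S \<subseteq> {..<card S}"
    using assms(1) by (auto intro!: psubset_card_mono)
  ultimately show ?thesis
    by (simp add: bij_betw_def card_image card_subset_eq)
qed

section \<open>Rotated allocations\<close>

text \<open>The bound \<open>k\<close> on the agents consulted is the loop counter of the program below.\<close>

definition approval_rank :: "('a \<Rightarrow> nat) \<Rightarrow> nat \<Rightarrow> 'a set \<Rightarrow> (nat \<Rightarrow> 'a set \<Rightarrow> real) \<Rightarrow> 'a \<Rightarrow> nat" where
  "approval_rank f k M v g =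
     card {h\<in>M. f h < f g \<and> (\<exists>i\<in>{1..k}. g \<in> approval_set M v i \<and> h \<in> approval_set M v i)}"

text \<open>\<open>Suc\<close> turns residues, which start at 0, into agents, which start at 1. The
  restriction makes the tuple extensional, as \<open>allocation\<close> demands.\<close>

definition rotation :: "nat \<Rightarrow> 'a set \<Rightarrow> ('a \<Rightarrow> nat) \<Rightarrow> nat \<Rightarrow> nat \<Rightarrow> 'a set" where
  "rotation n M p r = (\<lambda>i\<in>{1..n}. {g\<in>M. Suc ((p g + r) mod n) = i})"

definition rotation_pmf :: "nat \<Rightarrow> 'a set \<Rightarrow> ('a \<Rightarrow> nat) \<Rightarrow> (nat \<Rightarrow> 'a set) pmf" where
  "rotation_pmf n M p = map_pmf (rotation n M p) (pmf_of_set {..<n})"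

lemma rotation_apply:
  "i \<in> {1..n} \<Longrightarrow> rotation n M p r i = {g\<in>M. (p g + r) mod n = i - 1}"
  by (auto simp: rotation_def)

lemma allocation_rotation:
  assumes "1 \<le> n"
  shows "allocation n M (rotation n M p r)"
  using assms
  by (auto simp: allocation_def rotation_def disjoint_family_on_def Suc_le_eq)

text \<open>The owner of a single item already reveals the rotation. Without items all rotations
  coincide.\<close>

lemma inj_on_rotation:
  assumes "M \<noteq> {}"
  shows "inj_on (rotation n M p) {..<n}"
proof (rule inj_onI)
  fix r s assume rs: "r \<in> {..<n}" "s \<in> {..<n}" and eq: "rotation n M p r = rotation n M p s"
  obtain g where g: "g \<in> M" using assms by blast
  define i where "i = (p g + r) mod n"
  have i: "i < n" "Suc i \<in> {1..n}" using rs by (auto simp: i_def Suc_le_eq)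
  have "g \<in> rotation n M p r (Suc i)" using g i by (simp add: rotation_apply i_def)
  then have "(p g + s) mod n = i" using i eq by (simp add: rotation_apply)
  then have "r \<in> {r\<in>{..<n}. (p g + r) mod n = i}" "s \<in> {r\<in>{..<n}. (p g + r) mod n = i}"
    using rs by (auto simp: i_def)
  then show "r = s"
    using card_add_mod_eq[OF i(1), of "p g"] by (metis card_1_singletonE singletonD)
qed

lemma set_rotation_pmf: "1 \<le> n \<Longrightarrow> set_pmf (rotation_pmf n M p) = rotation n M p ` {..<n}"
  unfolding rotation_pmf_def set_map_pmf by (subst set_pmf_of_set) (auto simp: lessThan_empty_iff)

text \<open>By injectivity exactly one of the \<open>n\<close> equally likely values of
  \<open>r\<close> leads to the given outcome.\<close>

lemma pmf_rotation_pmf: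
  assumes "r < n" "M \<noteq> {}"
  shows "pmf (rotation_pmf n M p) (rotation n M p r) = 1 / real n"
proof -
  have "pmf (rotation_pmf n M p) (rotation n M p r) =
     measure (measure_pmf (pmf_of_set {..<n})) ({..<n} \<inter> rotation n M p -` {rotation n M p r})"
    using assms(1) unfolding rotation_pmf_def pmf_map
    by (subst measure_Int_set_pmf[symmetric]) (subst set_pmf_of_set; force simp: Int_commute)
  also have "{..<n} \<inter> rotation n M p -` {rotation n M p r} = {r}"
    using inj_on_rotation[OF assms(2), of n p] assms(1) by (auto simp: inj_on_def)
  also have "measure (measure_pmf (pmf_of_set {..<n})) {r} = 1 / real n"
    using assms(1) by (subst measure_pmf_single, subst pmf_of_set) auto
  finally show ?thesis .
qed

lemma pmf_rotation_pmf_empty: "1 \<le> n \<Longrightarrow> pmf (rotation_pmf n {} p) (rotation n {} p r) = 1"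
  unfolding rotation_pmf_def rotation_def by (simp add: map_pmf_const del: restrict_apply)

section \<open>Normalized binary instances with laminar approval sets\<close>

locale laminar_instance =
  fixes n :: nat and M :: "'a set" and v :: "nat \<Rightarrow> 'a set \<Rightarrow> real"
  assumes inst: "fair_division_instance n M v"
    and binary: "binary_goods n M v"
    and norm: "normalized n M v"
    and laminar: "laminar_approvals n M v"
begin

abbreviation \<Gamma> :: "nat \<Rightarrow> 'a set" where "\<Gamma> \<equiv> approval_set M v"

lemma n_pos: "1 \<le> n" and finite_items: "finite M"
  using inst by (auto simp: fair_division_instance_def)

lemma approval_subset: "\<Gamma> i \<subseteq> M"
  by (auto simp: approval_set_def)

lemma finite_approval: "finite (\<Gamma> i)"
  using approval_subset finite_items by (rule finite_subset)

lemma value_sum: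
  assumes "i \<in> {1..n}" "S \<subseteq> M"
  shows "v i S = (\<Sum>g\<in>S. v i {g})"
  using inst assms by (simp add: fair_division_instance_def additive_valuation_def)

lemma value_card:
  assumes i: "i \<in> {1..n}" and S: "S \<subseteq> M"
  shows "v i S = real (card (S \<inter> \<Gamma> i))"
proof -
  have fin: "finite S" using S finite_items by (rule finite_subset)
  have "v i S = (\<Sum>g\<in>S. v i {g})" using i S by (rule value_sum)
  also have "\<dots> = (\<Sum>g\<in>S. of_bool (g \<in> \<Gamma> i))"
    using binary i S by (intro sum.cong) (fastforce simp: binary_goods_def approval_set_def)+
  finally show ?thesis using fin by (simp add: Int_def)
qed

lemma card_approval_eq:
  assumes "i \<in> {1..n}" "j \<in> {1..n}"
  shows "card (\<Gamma> i) = card (\<Gamma> j)"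
proof -
  have "v k M = real (card (\<Gamma> k))" if "k \<in> {1..n}" for k
    using value_card[OF that order_refl] approval_subset by (simp add: Int_absorb1)
  moreover have "v i M = v j M" using norm assms unfolding normalized_def by blast
  ultimately show ?thesis using assms by simp
qed

text \<open>A common item excludes disjointness, so laminarity gives an inclusion, and an inclusion
  between finite sets of equal size is an equality. Laminarity enters the proof only here.\<close>

lemma approval_eq:
  assumes "i \<in> {1..n}" "j \<in> {1..n}" "g \<in> \<Gamma> i" "g \<in> \<Gamma> j"
  shows "\<Gamma> i = \<Gamma> j"
proof -
  have "\<Gamma> i \<subseteq> \<Gamma> j \<or> \<Gamma> j \<subseteq> \<Gamma> i"
    using laminar assms unfolding laminar_approvals_def by blast
  then show ?thesis
    using card_approval_eq[OF assms(1,2)] finite_approval card_subset_eq by metis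
qed

text \<open>All agents approving \<open>g\<close> have the same approval set, so the existential
  quantifier over agents collapses to any one of them. This makes the rank of an item independent of
  the agent considered.\<close>

lemma approval_rank_eq:
  assumes "k \<le> n" "i \<in> {1..k}" "g \<in> \<Gamma> i"
  shows "approval_rank f k M v g = card {h\<in>\<Gamma> i. f h < f g}"
proof -
  have "{h\<in>M. f h < f g \<and> (\<exists>j\<in>{1..k}. g \<in> \<Gamma> j \<and> h \<in> \<Gamma> j)} = {h\<in>\<Gamma> i. f h < f g}"
    using approval_eq[of _ i g] assms approval_subset by fastforce
  then show ?thesis by (simp add: approval_rank_def)
qed

text \<open>This is the common core of EF1 and EQ1. Removing an approved item lowers the value by 1;
  if no item is approved, the value is 0 from the start.\<close>

lemma value_remove_item:
  assumes "j \<in> {1..n}" "S \<subseteq> M" "S \<noteq> {}" "v j S \<le> 1 + c" "0 \<le> c"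
  shows "\<exists>g\<in>S. v j (S - {g}) \<le> c"
proof (cases "S \<inter> \<Gamma> j = {}")
  case True
  have "v j (S - {g}) = 0" for g
  proof -
    have "(S - {g}) \<inter> \<Gamma> j = {}" "S - {g} \<subseteq> M" using True assms(2) by blast+
    then show ?thesis using value_card[OF assms(1)] by simp
  qed
  moreover obtain g where "g \<in> S" using assms(3) by blast
  ultimately show ?thesis using assms(5) by auto
next
  case False
  then obtain g where g: "g \<in> S" "g \<in> \<Gamma> j" by auto
  have fin: "finite S" using assms finite_items finite_subset by blast
  have "v j S = v j (S - {g}) + v j {g}"
    using value_sum[OF assms(1,2)] value_sum[OF assms(1) subset_trans[OF Diff_subset assms(2)], of "{g}"]
      sum.remove[OF fin g(1), of "\<lambda>g. v j {g}"] by auto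
  then have "v j (S - {g}) = v j S - 1" using g by (simp add: approval_set_def)
  then show ?thesis using g(1) assms(4) by (intro bexI[of _ g]) auto
qed

text \<open>Each item reaches agent \<open>j\<close> in exactly one of the \<open>n\<close>
  rotations. This holds for every numbering \<open>p\<close>; the ranks matter only for the ex-post
  properties.\<close>

lemma expectation_rotation_pmf:
  assumes "i \<in> {1..n}" "j \<in> {1..n}"
  shows "measure_pmf.expectation (rotation_pmf n M p) (\<lambda>A. v i (A j)) = v i M / real n"
proof -
  have j: "j - 1 < n" using assms by auto
  have "measure_pmf.expectation (rotation_pmf n M p) (\<lambda>A. v i (A j)) =
      (\<Sum>r<n. v i (rotation n M p r j)) / real n"
    unfolding rotation_pmf_def using j by (simp add: integral_pmf_of_set lessThan_empty_iff)
  also have "(\<Sum>r<n. v i (rotation n M p r j)) =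
      (\<Sum>r<n. \<Sum>g\<in>M. v i {g} * of_bool ((p g + r) mod n = j - 1))"
  proof (rule sum.cong)
    fix r
    have "v i (rotation n M p r j) = (\<Sum>g\<in>{g\<in>M. (p g + r) mod n = j - 1}. v i {g})"
      unfolding rotation_apply[OF assms(2)] using assms(1) by (rule value_sum) auto
    also have "\<dots> = (\<Sum>g\<in>M. if (p g + r) mod n = j - 1 then v i {g} else 0)"
      using finite_items by (rule sum.inter_filter)
    also have "\<dots> = (\<Sum>g\<in>M. v i {g} * of_bool ((p g + r) mod n = j - 1))"
      by (intro sum.cong) auto
    finally show "v i (rotation n M p r j) =
        (\<Sum>g\<in>M. v i {g} * of_bool ((p g + r) mod n = j - 1))" .
  qed simp
  \<comment> \<open>With the sums exchanged, the inner sum counts the rotations that give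
    \<open>g\<close> to agent \<open>j\<close>.\<close>
  also have "\<dots> = (\<Sum>g\<in>M. v i {g} * real (card {r\<in>{..<n}. (p g + r) mod n = j - 1}))"
    by (subst sum.swap) (simp add: sum_distrib_left[symmetric] Int_def)
  also have "\<dots> = v i M"
    using card_add_mod_eq[OF j] value_sum[OF assms(1) order_refl] by simp
  finally show ?thesis .
qed

section \<open>Fairness of rotation by approval ranks\<close>

context
  fixes f :: "'a \<Rightarrow> nat"
  assumes inj: "inj_on f M"
begin

text \<open>Ranks number \<open>\<Gamma> i\<close> bijectively from 0 on, so counting items becomes
  counting integers. The result depends on \<open>i\<close> only through
  \<open>card (\<Gamma> i)\<close>, which is the same for all agents.\<close>

lemma card_approved_share:
  assumes "i \<in> {1..n}"
  shows "card {g\<in>\<Gamma> i. (approval_rank f n M v g + r) mod n = a} =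
    card {x\<in>{..<card (\<Gamma> i)}. (x + r) mod n = a}"
proof -
  let ?rk = "\<lambda>g. card {h\<in>\<Gamma> i. f h < f g}"
  have bij: "bij_betw ?rk (\<Gamma> i) {..<card (\<Gamma> i)}"
    using inj approval_subset finite_approval by (intro bij_betw_rank) (auto intro: inj_on_subset)
  have "card {g\<in>\<Gamma> i. (?rk g + r) mod n = a} = card (?rk ` {g\<in>\<Gamma> i. (?rk g + r) mod n = a})"
    using bij by (intro card_image[symmetric]) (auto simp: bij_betw_def intro: inj_on_subset)
  also have "?rk ` {g\<in>\<Gamma> i. (?rk g + r) mod n = a} =
      {x\<in>?rk ` \<Gamma> i. (x + r) mod n = a}" by blast
  also have "?rk ` \<Gamma> i = {..<card (\<Gamma> i)}"
    using bij by (simp add: bij_betw_def)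
  also have "{g\<in>\<Gamma> i. (?rk g + r) mod n = a} = {g\<in>\<Gamma> i. (approval_rank f n M v g + r) mod n = a}"
    using approval_rank_eq[OF order_refl assms] by auto
  finally show ?thesis .
qed

lemma value_rotation:
  assumes "i \<in> {1..n}" "j \<in> {1..n}"
  shows "v i (rotation n M (approval_rank f n M v) r j) =
    real (card {x\<in>{..<card (\<Gamma> i)}. (x + r) mod n = j - 1})"
proof -
  have "{g\<in>M. (approval_rank f n M v g + r) mod n = j - 1} \<inter> \<Gamma> i =
      {g\<in>\<Gamma> i. (approval_rank f n M v g + r) mod n = j - 1}"
    using approval_subset by auto
  then show ?thesis
    using assms card_approved_share[OF assms(1)] by (simp add: value_card rotation_apply)
qed

text \<open>The agent \<open>k\<close> who values the bundle of \<open>j\<close> is left free, so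
  that one bound serves both envy and equitability.\<close>

lemma value_rotation_le:
  assumes "i \<in> {1..n}" "j \<in> {1..n}" "k \<in> {1..n}" "r < n"
  shows "v k (rotation n M (approval_rank f n M v) r j) \<le>
    1 + v i (rotation n M (approval_rank f n M v) r i)"
proof -
  have "j - 1 < n" "i - 1 < n" using assms by auto
  then show ?thesis
    using card_shifted_residue_le[OF assms(4), of "j - 1" "i - 1" "card (\<Gamma> i)"]
      card_approval_eq[OF assms(1,3)] assms by (simp add: value_rotation)
qed

lemma rotation_EF1_EQ1:
  assumes "r < n"
  shows "EF1 n v (rotation n M (approval_rank f n M v) r)"
    "EQ1 n v (rotation n M (approval_rank f n M v) r)"
proof -
  let ?A = "rotation n M (approval_rank f n M v) r"
  have sub: "?A j \<subseteq> M" if "j \<in> {1..n}" for j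
    using that by (auto simp: rotation_apply)
  \<comment> \<open>The choice \<open>k = i\<close> yields EF1 and the choice \<open>k = j\<close>
    yields EQ1.\<close>
  have "\<exists>g\<in>?A j. v k (?A j - {g}) \<le> v i (?A i)"
    if "i \<in> {1..n}" "j \<in> {1..n}" "k \<in> {1..n}" "?A j \<noteq> {}" for i j k
    using that assms value_rotation_le[of i j k r] sub
    by (intro value_remove_item) (auto simp: value_card)
  then show "EF1 n v ?A" "EQ1 n v ?A" by (auto simp: EF1_def EQ1_def)
qed

lemma rotation_pmf_fair:
  defines "D \<equiv> rotation_pmf n M (approval_rank f n M v)"
  shows "randomized_allocation n M D" "ex_ante_EF n v D" "ex_ante_EQ n v D"
    "ex_post (EF1 n v) D" "ex_post (EQ1 n v) D"
proof -
  have supp: "set_pmf D = rotation n M (approval_rank f n M v) ` {..<n}"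
    unfolding D_def using n_pos by (rule set_rotation_pmf)
  show "randomized_allocation n M D"
    unfolding randomized_allocation_def supp using allocation_rotation[OF n_pos] by blast
  show "ex_post (EF1 n v) D" "ex_post (EQ1 n v) D"
    unfolding ex_post_def supp using rotation_EF1_EQ1 by blast+
  \<comment> \<open>Both expectations equal \<open>v i M / real n\<close>, so the inequality holds
    with equality.\<close>
  show "ex_ante_EF n v D"
    unfolding ex_ante_EF_def D_def by (simp add: expectation_rotation_pmf)
  show "ex_ante_EQ n v D"
    unfolding ex_ante_EQ_def D_def
  proof (intro ballI)
    fix i j assume ij: "i \<in> {1..n}" "j \<in> {1..n}"
    then have "v i M = v j M" using norm unfolding normalized_def by blast
    then show "measure_pmf.expectation (rotation_pmf n M (approval_rank f n M v)) (\<lambda>A. v i (A i)) =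
        measure_pmf.expectation (rotation_pmf n M (approval_rank f n M v)) (\<lambda>A. v j (A j))"
      using ij by (simp only: expectation_rotation_pmf)
  qed
qed

end

end

section \<open>Timed Hoare triples\<close>

text \<open>Total correctness: halting within \<open>T\<close> steps is part of the claim. Keeping
  only an upper bound lets branches of unequal cost share one triple.\<close>

definition triple :: "(mstate \<Rightarrow> bool) \<Rightarrow> prog \<Rightarrow> nat \<Rightarrow> (mstate \<Rightarrow> bool) \<Rightarrow> bool" where
  "triple P c T Q \<longleftrightarrow> (\<forall>s. P s \<longrightarrow> (\<exists>t s'. exec c s t s' \<and> t \<le> T \<and> Q s'))"

primrec straight_line :: "prog \<Rightarrow> bool" where
  "straight_line Skip = True"
| "straight_line (Assign r e) = True"
| "straight_line (Store d e) = True"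
| "straight_line (Write e) = True"
| "straight_line (Seq c d) = (straight_line c \<and> straight_line d)"
| "straight_line (If b c d) = (straight_line c \<and> straight_line d)"
| "straight_line (While b c) = False"

text \<open>The value on \<open>While\<close> is a placeholder; \<open>straight_line\<close>
  excludes loops. On loop-free code the final state can be computed by rewriting.\<close>

primrec run_straight :: "prog \<Rightarrow> mstate \<Rightarrow> mstate" where
  "run_straight Skip s = s"
| "run_straight (Assign r e) s = s\<lparr>regs := (regs s)(r := eval_expr e s)\<rparr>"
| "run_straight (Store d e) s = s\<lparr>mem := (mem s)(eval_expr d s := eval_expr e s)\<rparr>"
| "run_straight (Write e) s = s\<lparr>outp := outp s @ [eval_expr e s]\<rparr>"
| "run_straight (Seq c d) s = run_straight d (run_straight c s)"
| "run_straight (If b c d) s =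
    (if eval_expr b s \<noteq> 0 then run_straight c s else run_straight d s)"
| "run_straight (While b c) s = s"

text \<open>Only an upper bound: both branches of a conditional are charged.\<close>

primrec cost_straight :: "prog \<Rightarrow> nat" where
  "cost_straight Skip = 1"
| "cost_straight (Assign r e) = cost_expr e + 1"
| "cost_straight (Store d e) = cost_expr d + cost_expr e + 1"
| "cost_straight (Write e) = cost_expr e + 1"
| "cost_straight (Seq c d) = cost_straight c + cost_straight d"
| "cost_straight (If b c d) = cost_expr b + 1 + cost_straight c + cost_straight d"
| "cost_straight (While b c) = 0"

lemma exec_straight:
  "straight_line c \<Longrightarrow> \<exists>t\<le>cost_straight c. exec c s t (run_straight c s)"
proof (induction c arbitrary: s)
  case (Seq c d)
  then obtain t t' where "t \<le> cost_straight c" "exec c s t (run_straight c s)"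
    "t' \<le> cost_straight d" "exec d (run_straight c s) t' (run_straight d (run_straight c s))"
    by (metis straight_line.simps(5))
  then show ?case by (auto intro!: exI[of _ "t + t'"] exec.Seq)
next
  case (If b c d)
  show ?case
  proof (cases "eval_expr b s = 0")
    case True
    with If obtain t where "t \<le> cost_straight d" "exec d s t (run_straight d s)" by auto
    with True show ?thesis
      using exec.IfFalse[of b s d t _ c] by (intro exI[of _ "cost_expr b + 1 + t"]) simp
  next
    case False
    with If obtain t where "t \<le> cost_straight c" "exec c s t (run_straight c s)" by auto
    with False show ?thesis
      using exec.IfTrue[of b s c t _ d] by (intro exI[of _ "cost_expr b + 1 + t"]) simp
  qed
next
  case (While b c)
  then show ?case by simp
qed (simp, rule exI, rule conjI[rotated], rule exec.Skip exec.Assign exec.Store exec.Write, simp)+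

lemma triple_straight:
  assumes "straight_line c" "\<And>s. P s \<Longrightarrow> Q (run_straight c s)"
  shows "triple P c (cost_straight c) Q"
  using exec_straight[OF assms(1)] assms(2) unfolding triple_def by meson

lemma triple_Seq:
  assumes "triple P c T Q" "triple Q d U R"
  shows "triple P (Seq c d) (T + U) R"
  unfolding triple_def
proof (intro allI impI)
  fix s assume "P s"
  then obtain t s' where c: "exec c s t s'" "t \<le> T" "Q s'"
    using assms(1) unfolding triple_def by blast
  then obtain t' s'' where d: "exec d s' t' s''" "t' \<le> U" "R s''"
    using assms(2) unfolding triple_def by blast
  have "t + t' \<le> T + U" using c(2) d(2) by (rule add_mono)
  then show "\<exists>t s'. exec (Seq c d) s t s' \<and> t \<le> T + U \<and> R s'"
    using exec.Seq[OF c(1) d(1)] d(3) by blast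
qed

lemma triple_conseq:
  assumes "triple P c T Q" "\<And>s. P' s \<Longrightarrow> P s" "T \<le> T'" "\<And>s. Q s \<Longrightarrow> Q' s"
  shows "triple P' c T' Q'"
  using assms unfolding triple_def by (meson le_trans)

text \<open>The invariant is indexed by the number of completed iterations, of which there are
  exactly \<open>N\<close>, so no separate termination measure is required. The summand after the
  product pays for the last, failing test.\<close>

lemma triple_While:
  assumes body: "\<And>k. k < N \<Longrightarrow> triple (I k) c T (I (Suc k))"
    and continue: "\<And>k s. k < N \<Longrightarrow> I k s \<Longrightarrow> eval_expr b s \<noteq> 0"
    and exit: "\<And>s. I N s \<Longrightarrow> eval_expr b s = 0"
  shows "triple (I 0) (While b c) (N * (cost_expr b + 1 + T) + cost_expr b + 1) (I N)"
proof -
  \<comment> \<open>Here \<open>k\<close> is the number of iterations still to come.\<close>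
  have "triple (I (N - k)) (While b c) (k * (cost_expr b + 1 + T) + cost_expr b + 1) (I N)"
    if "k \<le> N" for k
    using that
  proof (induction k)
    case 0
    have "exec (While b c) s (cost_expr b + 1) s" if "I N s" for s
      using exit[OF that] by (rule exec.WhileFalse)
    then show ?case unfolding triple_def by auto
  next
    case (Suc k)
    show ?case
      unfolding triple_def
    proof (intro allI impI)
      fix s assume I: "I (N - Suc k) s"
      have lt: "N - Suc k < N" and eq: "Suc (N - Suc k) = N - k" using Suc.prems by auto
      obtain t s' where c: "exec c s t s'" "t \<le> T" "I (N - k) s'"
        using body[OF lt, unfolded triple_def eq, rule_format, OF I] by blast
      then obtain t' s'' where w: "exec (While b c) s' t' s''" "I N s''"
        "t' \<le> k * (cost_expr b + 1 + T) + cost_expr b + 1"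
        using Suc.IH[OF Suc_leD[OF Suc.prems], unfolded triple_def, rule_format, OF c(3)] by blast
      have "exec (While b c) s (cost_expr b + 1 + t + t') s''"
        using continue[OF lt I] c(1) w(1) by (rule exec.WhileTrue)
      then show "\<exists>t s'. exec (While b c) s t s' \<and>
          t \<le> Suc k * (cost_expr b + 1 + T) + cost_expr b + 1 \<and> I N s'"
        using c(2) w(2,3) by (intro exI[of _ "cost_expr b + 1 + t + t'"] exI[of _ s'']) simp
    qed
  qed
  from this[of N] show ?thesis by simp
qed

text \<open>The machine has no division. A sum of two residues is below \<open>2 * n\<close>, so one
  comparison and at most one subtraction reduce it.\<close>

lemma add_mod_wrap:
  fixes n :: nat
  assumes "r < n"
  shows "(x + r) mod n = (if x mod n + r < n then x mod n + r else x mod n + r - n)"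
proof -
  have "x mod n < n" using assms by simp
  then have "x mod n + r - n < n" using assms by linarith
  then have "(x mod n + r) mod n = (if x mod n + r < n then x mod n + r else x mod n + r - n)"
    by (simp add: le_mod_geq)
  then show ?thesis by (simp only: mod_add_left_eq)
qed

section \<open>The program\<close>

lemma row_major_less:
  fixes i g m n :: nat
  assumes "i < n" "g < m"
  shows "i * m + g < n * m"
proof -
  have "i * m + g < Suc i * m" using assms(2) by simp
  also have "\<dots> \<le> n * m" using assms(1) by (intro mult_le_mono1) simp
  finally show ?thesis .
qed

text \<open>Induction on the number of rows: the last row starts at position \<open>n * m\<close>,
  and smaller positions lie in the earlier rows.\<close>

lemma nth_concat_rows:
  assumes "i < n" "g < m"
  shows "concat (map (\<lambda>i. map (f i) [1..<Suc m]) [1..<Suc n]) ! (i * m + g) = f (Suc i) (Suc g)"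
  using assms(1)
proof (induction n)
  case (Suc n)
  have len: "length (concat (map (\<lambda>i. map (f i) [1..<Suc m]) [1..<Suc n])) = n * m"
    by (simp add: length_concat comp_def sum_list_triv)
  have split: "concat (map (\<lambda>i. map (f i) [1..<Suc m]) [1..<Suc (Suc n)]) =
      concat (map (\<lambda>i. map (f i) [1..<Suc m]) [1..<Suc n]) @ map (f (Suc n)) [1..<Suc m]"
    by simp
  show ?case
  proof (cases "i = n")
    case True
    then show ?thesis unfolding split nth_append len using assms(2) by (simp del: upt_Suc)
  next
    case False
    then have "i < n" using Suc.prems by simp
    moreover from this have "i * m + g < n * m"
      using assms(2) row_major_less by blast
    ultimately show ?thesis unfolding split nth_append len using Suc.IH by simp
  qed
qed simp

text \<open>
  Registers: 0 the input length, 1 and 2 the numbers of agents and items, 3 the input address,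
  4 the current item, 5 the number modulo \<open>n\<close> of items approved so far by the current agent,
  6 the support size, 7 the rotation. The ranks modulo \<open>n\<close> are stored behind the input.
\<close>

definition parse_agents :: prog where
  "parse_agents = While (Mem (Reg 1)) (Assign 1 (Plus (Reg 1) (Const 1)))"

text \<open>The two assignments outside the loop skip the zeros that end the unary numbers;
  afterwards register 3 points to the first matrix entry.\<close>

definition parse_items :: prog where
  "parse_items =
     Seq (Assign 3 (Plus (Reg 1) (Const 1)))
    (Seq (While (Mem (Reg 3))
           (Seq (Assign 3 (Plus (Reg 3) (Const 1))) (Assign 2 (Plus (Reg 2) (Const 1)))))
         (Assign 3 (Plus (Reg 3) (Const 1))))"

text \<open>Truncated subtraction acts as a comparison: the inner test fails once the count reaches
  \<open>n\<close>, and the count is reset to 0. Agents with the same approval set overwrite ranks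
  by equal values.\<close>

definition rank_item :: prog where
  "rank_item =
     Seq (If (Mem (Reg 3))
           (Seq (Store (Plus (Reg 0) (Reg 4)) (Reg 5))
           (Seq (Assign 5 (Plus (Reg 5) (Const 1)))
                (If (Minus (Reg 1) (Reg 5)) Skip (Assign 5 (Const 0)))))
           Skip)
    (Seq (Assign 3 (Plus (Reg 3) (Const 1)))
         (Assign 4 (Plus (Reg 4) (Const 1))))"

definition rank_items :: prog where
  "rank_items =
     While (Minus (Reg 0) (Reg 3))
       (Seq (Seq (Assign 4 (Const 0)) (Assign 5 (Const 0)))
            (While (Minus (Reg 2) (Reg 4)) rank_item))"

text \<open>The two branches are the two cases of \<open>add_mod_wrap\<close>; adding 1 turns the
  residue into an agent.\<close>

definition write_owner :: prog where
  "write_owner =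
     (let p = Plus (Mem (Plus (Reg 0) (Reg 4))) (Reg 7) in
      Seq (If (Minus (Reg 1) p)
            (Write (Plus p (Const 1)))
            (Write (Plus (Minus p (Reg 1)) (Const 1))))
          (Assign 4 (Plus (Reg 4) (Const 1))))"

definition write_rotations :: prog where
  "write_rotations =
     Seq (If (Reg 2) (Assign 6 (Reg 1)) (Assign 6 (Const 1)))
         (While (Minus (Reg 6) (Reg 7))
           (Seq (Seq (Write (Const 1)) (Seq (Write (Reg 6)) (Assign 4 (Const 0))))
           (Seq (While (Minus (Reg 2) (Reg 4)) write_owner)
                (Assign 7 (Plus (Reg 7) (Const 1))))))"

definition fair_prog :: prog where
  "fair_prog = Seq parse_agents (Seq parse_items (Seq rank_items write_rotations))"

section \<open>Layout of the encoded input\<close>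

lemma length_encode_instance: "length (encode_instance n m v) = n + m + 2 + n * m"
  by (simp add: encode_instance_def length_concat comp_def sum_list_triv)

lemma encode_instance_nth:
  "a < n \<Longrightarrow> encode_instance n m v ! a"
  "\<not> encode_instance n m v ! n"
  "a < m \<Longrightarrow> encode_instance n m v ! (n + 1 + a)"
  "\<not> encode_instance n m v ! (n + 1 + m)"
  "i < n \<Longrightarrow> g < m \<Longrightarrow> encode_instance n m v ! (n + m + 2 + i * m + g) = (v (Suc i) {Suc g} = 1)"
proof -
  assume ig: "i < n" "g < m"
  have "encode_instance n m v ! (n + m + 2 + i * m + g) =
      concat (map (\<lambda>i. map (\<lambda>g. v i {g} = 1) [1..<Suc m]) [1..<Suc n]) ! (i * m + g)"
    by (simp add: encode_instance_def nth_append del: upt_Suc)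
  then show "encode_instance n m v ! (n + m + 2 + i * m + g) = (v (Suc i) {Suc g} = 1)"
    using nth_concat_rows[OF ig] by (simp del: upt_Suc)
qed (simp_all add: encode_instance_def nth_append nth_Cons' del: upt_Suc)


section \<open>Correctness and running time on encoded instances\<close>

locale encoded_instance = laminar_instance n "{1..m}" v
  for n m :: nat and v :: "nat \<Rightarrow> nat set \<Rightarrow> real"
begin

abbreviation input :: "bool list" where "input \<equiv> encode_instance n m v"

abbreviation rk :: "nat \<Rightarrow> nat \<Rightarrow> nat" where "rk k \<equiv> approval_rank id k {1..m} v"

text \<open>This is the effect of reading one matrix entry. If agent \<open>Suc i\<close> approves
  the item, its rank is its position in that agent's approval set, whatever earlier agents
  contributed; otherwise this agent contributes nothing.\<close>

lemma approval_rank_Suc: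
  assumes "i < n" "g < m"
  shows "rk (Suc i) (Suc g) =
      (if Suc g \<in> \<Gamma> (Suc i) then card {h\<in>\<Gamma> (Suc i). h < Suc g} else rk i (Suc g))"
    and "card {h\<in>\<Gamma> (Suc i). h < Suc (Suc g)} =
      card {h\<in>\<Gamma> (Suc i). h < Suc g} + of_bool (Suc g \<in> \<Gamma> (Suc i))"
proof -
  show "rk (Suc i) (Suc g) =
      (if Suc g \<in> \<Gamma> (Suc i) then card {h\<in>\<Gamma> (Suc i). h < Suc g} else rk i (Suc g))"
  proof (cases "Suc g \<in> \<Gamma> (Suc i)")
    case True
    then show ?thesis using assms approval_rank_eq[of "Suc i" "Suc i" "Suc g" id] by simp
  next
    case False
    then have "(\<exists>j\<in>{1..Suc i}. Suc g \<in> \<Gamma> j \<and> h \<in> \<Gamma> j) \<longleftrightarrow> (\<exists>j\<in>{1..i}. Suc g \<in> \<Gamma> j \<and> h \<in> \<Gamma> j)"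
      for h by (metis atLeastAtMost_iff le_Suc_eq)
    then show ?thesis using False unfolding approval_rank_def by simp
  qed
  have "{h\<in>\<Gamma> (Suc i). h < Suc (Suc g)} =
      (if Suc g \<in> \<Gamma> (Suc i) then insert (Suc g) {h\<in>\<Gamma> (Suc i). h < Suc g}
       else {h\<in>\<Gamma> (Suc i). h < Suc g})"
    by (auto simp: less_Suc_eq)
  then show "card {h\<in>\<Gamma> (Suc i). h < Suc (Suc g)} =
      card {h\<in>\<Gamma> (Suc i). h < Suc g} + of_bool (Suc g \<in> \<Gamma> (Suc i))"
    using finite_approval by simp
qed

text \<open>Register 7 is tracked from the start because the output loop relies on its initial value
  0.\<close>

definition parsed :: "nat \<Rightarrow> nat \<Rightarrow> mstate \<Rightarrow> bool" where
  "parsed a b s \<longleftrightarrow> regs s 0 = length input \<and> regs s 1 = a \<and> regs s 2 = b \<and> regs s 7 = 0 \<and>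
     mem s = mem (initial_state input) \<and> outp s = []"

lemma parse_agents: "triple (parsed 0 0) parse_agents (7 * n + 3) (parsed n 0)"
proof -
  let ?c = "Assign 1 (Plus (Reg 1) (Const 1))"
  have "triple (parsed k 0) ?c (cost_straight ?c) (parsed (Suc k) 0)" for k
    by (rule triple_straight) (auto simp: parsed_def)
  then have "triple (parsed 0 0) parse_agents
      (n * (cost_expr (Mem (Reg 1)) + 1 + cost_straight ?c) + cost_expr (Mem (Reg 1)) + 1)
      (parsed n 0)"
    unfolding parse_agents_def
    by (rule triple_While[where I = "\<lambda>k. parsed k 0"])
      (auto simp: parsed_def initial_state_def length_encode_instance encode_instance_nth)
  then show ?thesis by (rule triple_conseq) auto
qed

lemma parse_items:
  "triple (parsed n 0) parse_items (11 * m + 11) (\<lambda>s. parsed n m s \<and> regs s 3 = n + m + 2)"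
proof -
  let ?I = "\<lambda>k s. parsed n k s \<and> regs s 3 = n + 1 + k"
  let ?c = "Seq (Assign 3 (Plus (Reg 3) (Const 1))) (Assign 2 (Plus (Reg 2) (Const 1)))"
  let ?d = "Assign 3 (Plus (Reg 1) (Const 1))" and ?e = "Assign 3 (Plus (Reg 3) (Const 1))"
  have "triple (?I k) ?c (cost_straight ?c) (?I (Suc k))" for k
    by (rule triple_straight) (auto simp: parsed_def)
  then have loop: "triple (?I 0) (While (Mem (Reg 3)) ?c)
      (m * (cost_expr (Mem (Reg 3)) + 1 + cost_straight ?c) + cost_expr (Mem (Reg 3)) + 1) (?I m)"
    using encode_instance_nth(3)[of _ m n v] encode_instance_nth(4)[of n m v]
    by (intro triple_While) (auto simp: parsed_def initial_state_def length_encode_instance)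
  have start: "triple (parsed n 0) ?d (cost_straight ?d) (?I 0)"
    by (rule triple_straight) (auto simp: parsed_def)
  have "triple (?I m) ?e (cost_straight ?e) (\<lambda>s. parsed n m s \<and> regs s 3 = n + m + 2)"
    by (rule triple_straight) (auto simp: parsed_def)
  from triple_Seq[OF start triple_Seq[OF loop this]] show ?thesis
    unfolding parse_items_def by (rule triple_conseq) auto
qed

text \<open>\<open>i\<close> rows and \<open>g\<close> further entries have been read. Cells of the
  first \<open>g\<close> items already account for agent \<open>Suc i\<close>, the others only for
  the agents up to \<open>i\<close>.\<close>

definition ranking :: "nat \<Rightarrow> nat \<Rightarrow> mstate \<Rightarrow> bool" where
  "ranking i g s \<longleftrightarrow> regs s 0 = length input \<and> regs s 1 = n \<and> regs s 2 = m \<and>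
     regs s 3 = n + m + 2 + i * m + g \<and> regs s 7 = 0 \<and> outp s = [] \<and>
     (\<forall>a<length input. mem s a = of_bool (input ! a)) \<and>
     (\<forall>h<m. mem s (length input + h) = rk (if h < g then Suc i else i) (Suc h) mod n)"

text \<open>The machine counts items from 0, so the next item is \<open>Suc g\<close> and register 5
  counts the approved items before it.\<close>

definition ranking_row :: "nat \<Rightarrow> nat \<Rightarrow> mstate \<Rightarrow> bool" where
  "ranking_row i g s \<longleftrightarrow> ranking i g s \<and> regs s 4 = g \<and>
     regs s 5 = card {h\<in>\<Gamma> (Suc i). h < Suc g} mod n"

lemma rank_item:
  assumes "i < n" "g < m"
  shows "triple (ranking_row i g) rank_item 33 (ranking_row i (Suc g))"
proof -
  define B where "B \<longleftrightarrow> Suc g \<in> \<Gamma> (Suc i)"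
  define C where "C = (\<lambda>g. card {h\<in>\<Gamma> (Suc i). h < g})"
  define N where "N = length input"
  have C: "C (Suc (Suc g)) = C (Suc g) + of_bool B"
    using approval_rank_Suc(2)[OF assms] by (simp only: B_def C_def)
  have rk: "rk (Suc i) (Suc g) = (if B then C (Suc g) else rk i (Suc g))"
    using approval_rank_Suc(1)[OF assms] by (simp only: B_def C_def)
  have lt: "n + m + 2 + i * m + g < N"
    using row_major_less[OF assms] by (simp add: N_def length_encode_instance)
  have "triple (ranking_row i g) rank_item (cost_straight rank_item) (ranking_row i (Suc g))"
  proof (rule triple_straight)
    fix s assume "ranking_row i g s"
    then have s: "regs s 0 = N" "regs s 1 = n" "regs s 2 = m" "regs s 3 = n + m + 2 + i * m + g"
      "regs s 4 = g" "regs s 5 = C (Suc g) mod n" "regs s 7 = 0" "outp s = []"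
      and input: "\<forall>a<N. mem s a = of_bool (input ! a)"
      and ranks: "\<forall>h<m. mem s (N + h) = rk (if h < g then Suc i else i) (Suc h) mod n"
      unfolding ranking_row_def ranking_def C_def N_def by blast+
    have bit: "mem s (n + m + 2 + i * m + g) = of_bool B"
      using input lt encode_instance_nth(5)[OF assms, of v] assms(2)
      by (simp add: B_def approval_set_def)
    \<comment> \<open>The residue is below \<open>n\<close>, so the test on the machine amounts to
      the equality that decides \<open>mod_Suc\<close>.\<close>
    have wrap: "n \<le> Suc (C (Suc g) mod n) \<longleftrightarrow> Suc (C (Suc g) mod n) = n"
      using mod_less_divisor[of n "C (Suc g)"] n_pos by linarith
    let ?s = "run_straight rank_item s"
    have mem': "mem ?s = (if B then (mem s)(N + g := C (Suc g) mod n) else mem s)"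
      using s bit by (simp add: rank_item_def)
    have "regs ?s 5 = C (Suc (Suc g)) mod n"
      using s bit C wrap by (cases B) (simp_all add: rank_item_def mod_Suc)
    moreover have "regs ?s 0 = N" "regs ?s 1 = n" "regs ?s 2 = m" "regs ?s 7 = 0" "outp ?s = []"
      "regs ?s 3 = n + m + 2 + i * m + Suc g" "regs ?s 4 = Suc g"
      using s bit by (simp_all add: rank_item_def)
    \<comment> \<open>The only store goes to an address behind the input.\<close>
    moreover have "\<forall>a<N. mem ?s a = of_bool (input ! a)"
      using input by (simp add: mem')
    moreover have "\<forall>h<m. mem ?s (N + h) = rk (if h < Suc g then Suc i else i) (Suc h) mod n"
    proof (intro allI impI)
      fix h assume "h < m"
      then show "mem ?s (N + h) = rk (if h < Suc g then Suc i else i) (Suc h) mod n"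
        using ranks rk by (cases "h = g") (simp_all add: mem' less_Suc_eq)
    qed
    ultimately show "ranking_row i (Suc g) ?s"
      unfolding ranking_row_def ranking_def C_def N_def by blast
  qed (simp add: rank_item_def)
  then show ?thesis by (rule triple_conseq) (simp_all add: rank_item_def)
qed

lemma rank_items:
  "triple (ranking 0 0) rank_items (n * (38 * m + 13) + 4) (ranking n 0)"
proof -
  let ?c = "Seq (Assign 4 (Const 0)) (Assign 5 (Const 0))"
  let ?b = "Minus (Reg 2) (Reg 4)"
  have row: "triple (ranking i 0) (Seq ?c (While ?b rank_item))
      (cost_straight ?c + (m * (cost_expr ?b + 1 + 33) + cost_expr ?b + 1)) (ranking (Suc i) 0)"
    if "i < n" for i
  proof (rule triple_Seq)
    have "{h\<in>\<Gamma> (Suc i). h < Suc 0} = {}" by (auto simp: approval_set_def)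
    then have "card {h\<in>\<Gamma> (Suc i). h < Suc 0} mod n = 0" by (simp only: card.empty mod_0)
    then show "triple (ranking i 0) ?c (cost_straight ?c) (ranking_row i 0)"
      by (intro triple_straight) (simp_all add: ranking_row_def ranking_def)
    have "triple (ranking_row i 0) (While ?b rank_item)
        (m * (cost_expr ?b + 1 + 33) + cost_expr ?b + 1) (ranking_row i m)"
      using rank_item[OF that] by (rule triple_While) (auto simp: ranking_row_def ranking_def)
    \<comment> \<open>A finished row \<open>i\<close> is the beginning of row
      \<open>Suc i\<close>.\<close>
    then show "triple (ranking_row i 0) (While ?b rank_item)
        (m * (cost_expr ?b + 1 + 33) + cost_expr ?b + 1) (ranking (Suc i) 0)"
      by (rule triple_conseq) (auto simp: ranking_row_def ranking_def)
  qed
  have pos: "length input - (n + m + 2 + i * m) \<noteq> 0" if "i < n" "0 < m" for i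
    using row_major_less[OF that] by (simp add: length_encode_instance)
  show ?thesis
  proof (cases "m = 0")
    \<comment> \<open>Without items the matrix is empty: register 3 already equals the input length,
      and the claim about ranks is vacuous.\<close>
    case True
    have "exec rank_items s (cost_expr (Minus (Reg 0) (Reg 3)) + 1) s" if "ranking 0 0 s" for s
      using that True unfolding rank_items_def ranking_def length_encode_instance
      by (intro exec.WhileFalse) simp
    moreover have "ranking n 0 s" if "ranking 0 0 s" for s
      using that True unfolding ranking_def by simp
    ultimately show ?thesis unfolding triple_def by fastforce
  next
    case False
    have "triple (ranking 0 0) rank_items
        (n * (cost_expr (Minus (Reg 0) (Reg 3)) + 1 +
          (cost_straight ?c + (m * (cost_expr ?b + 1 + 33) + cost_expr ?b + 1))) +
        cost_expr (Minus (Reg 0) (Reg 3)) + 1) (ranking n 0)"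
      unfolding rank_items_def using row
    proof (rule triple_While[where I = "\<lambda>i. ranking i 0"])
      show "eval_expr (Minus (Reg 0) (Reg 3)) s \<noteq> 0" if "i < n" "ranking i 0 s" for i s
        using pos[OF that(1)] that(2) False by (simp add: ranking_def)
      show "eval_expr (Minus (Reg 0) (Reg 3)) s = 0" if "ranking n 0 s" for s
        using that by (simp add: ranking_def length_encode_instance)
    qed
    then show ?thesis by (rule triple_conseq) (auto simp: algebra_simps)
  qed
qed

section \<open>Writing the distribution\<close>

abbreviation owner :: "nat \<Rightarrow> nat \<Rightarrow> nat" where
  "owner r g \<equiv> Suc ((rk n (Suc g) + r) mod n)"

text \<open>Without items all rotations coincide, and the output must list their common value once.\<close>

definition rounds :: nat where
  "rounds = (if m = 0 then 1 else n)"

lemma rounds_eq: "m = 0 \<Longrightarrow> rounds = 1" "m \<noteq> 0 \<Longrightarrow> rounds = n"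
  unfolding rounds_def by simp_all

definition written :: "nat \<Rightarrow> nat list" where
  "written r = concat (map (\<lambda>r. 1 # rounds # map (owner r) [0..<m]) [0..<r])"

definition writing :: "nat \<Rightarrow> mstate \<Rightarrow> bool" where
  "writing r s \<longleftrightarrow> regs s 0 = length input \<and> regs s 1 = n \<and> regs s 2 = m \<and>
     regs s 6 = rounds \<and> regs s 7 = r \<and>
     (\<forall>h<m. mem s (length input + h) = rk n (Suc h) mod n)"

definition writing_row :: "nat \<Rightarrow> nat \<Rightarrow> mstate \<Rightarrow> bool" where
  "writing_row r g s \<longleftrightarrow> writing r s \<and> regs s 4 = g \<and>
     outp s = written r @ [1, rounds] @ map (owner r) [0..<g]"

lemma write_owner:
  assumes "r < rounds" "g < m"
  shows "triple (writing_row r g) write_owner 50 (writing_row r (Suc g))"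
proof -
  \<comment> \<open>An item exists, so \<open>m\<close> is positive and \<open>rounds\<close> equals
    \<open>n\<close>.\<close>
  have "r < n" using assms by (auto simp: rounds_def)
  then have "(rk n (Suc g) + r) mod n =
      (if rk n (Suc g) mod n + r < n then rk n (Suc g) mod n + r else rk n (Suc g) mod n + r - n)"
    by (rule add_mod_wrap)
  then have "triple (writing_row r g) write_owner (cost_straight write_owner) (writing_row r (Suc g))"
    using assms(2)
    by (intro triple_straight) (simp_all add: write_owner_def writing_row_def writing_def Let_def)
  then show ?thesis by (rule triple_conseq) (auto simp: write_owner_def Let_def)
qed

lemma write_rotations:
  "triple (ranking n 0) write_rotations (100 * (n * m + n + 1)) (\<lambda>s. outp s = written rounds)"
proof -
  let ?b = "Minus (Reg 2) (Reg 4)" and ?b' = "Minus (Reg 6) (Reg 7)"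
  let ?c = "Seq (Write (Const 1)) (Seq (Write (Reg 6)) (Assign 4 (Const 0)))"
  let ?d = "Assign 7 (Plus (Reg 7) (Const 1))"
  let ?e = "If (Reg 2) (Assign 6 (Reg 1)) (Assign 6 (Const 1))"
  let ?I = "\<lambda>r s. writing r s \<and> outp s = written r"
  have step: "triple (?I r) (Seq ?c (Seq (While ?b write_owner) ?d))
      (cost_straight ?c + ((m * (cost_expr ?b + 1 + 50) + cost_expr ?b + 1) + cost_straight ?d))
      (?I (Suc r))" if "r < rounds" for r
  proof (intro triple_Seq)
    show "triple (?I r) ?c (cost_straight ?c) (writing_row r 0)"
      by (rule triple_straight) (auto simp: writing_row_def writing_def)
    show "triple (writing_row r 0) (While ?b write_owner)
        (m * (cost_expr ?b + 1 + 50) + cost_expr ?b + 1) (writing_row r m)"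
      using write_owner[OF that] by (rule triple_While) (auto simp: writing_row_def writing_def)
    show "triple (writing_row r m) ?d (cost_straight ?d) (?I (Suc r))"
      by (rule triple_straight) (auto simp: writing_row_def writing_def written_def)
  qed
  have "triple (ranking n 0) ?e (cost_straight ?e) (?I 0)"
    by (rule triple_straight) (auto simp: ranking_def writing_def written_def rounds_def)
  moreover from step have "triple (?I 0) (While ?b' (Seq ?c (Seq (While ?b write_owner) ?d)))
      (rounds * (cost_expr ?b' + 1 + (cost_straight ?c +
        ((m * (cost_expr ?b + 1 + 50) + cost_expr ?b + 1) + cost_straight ?d))) +
        cost_expr ?b' + 1) (?I rounds)"
    by (rule triple_While) (auto simp: writing_def)
  ultimately have "triple (ranking n 0) write_rotations (cost_straight ?e +
      (rounds * (cost_expr ?b' + 1 + (cost_straight ?c +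
        ((m * (cost_expr ?b + 1 + 50) + cost_expr ?b + 1) + cost_straight ?d))) +
        cost_expr ?b' + 1)) (?I rounds)"
    unfolding write_rotations_def by (rule triple_Seq)
  then show ?thesis
    by (rule triple_conseq) (use n_pos in \<open>auto simp: rounds_def algebra_simps\<close>)
qed

text \<open>The approval matrix is part of the input, so a running time of order
  \<open>n * m + n + m\<close> is linear in the input length.\<close>

lemma fair_prog:
  "triple (\<lambda>s. s = initial_state input) fair_prog (300 * length input) (\<lambda>s. outp s = written rounds)"
proof (rule triple_conseq)
  \<comment> \<open>With no agent consulted every rank is 0, which agrees with the zero cells behind
    the input.\<close>
  have items: "triple (parsed n 0) parse_items (11 * m + 11) (ranking 0 0)"
    by (rule triple_conseq[OF parse_items])
      (auto simp: parsed_def ranking_def initial_state_def approval_rank_def)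
  show "triple (parsed 0 0) fair_prog
      (7 * n + 3 + (11 * m + 11 + (n * (38 * m + 13) + 4 + 100 * (n * m + n + 1))))
      (\<lambda>s. outp s = written rounds)"
    unfolding fair_prog_def
    by (intro triple_Seq) (rule parse_agents items rank_items write_rotations)+
qed (auto simp: parsed_def initial_state_def length_encode_instance algebra_simps)

text \<open>\<open>rounds\<close> is the number of distinct rotations: \<open>n\<close> if there are
  items, and 1 otherwise. So the listed blocks cover the support, each with probability
  \<open>1 / rounds\<close>.\<close>

lemma encodes_written:
  "encodes_distribution n m (written rounds) (rotation_pmf n {1..m} (rk n))"
proof -
  define ow where "ow r = map (owner r) [0..<m]" for r
  define L where "L = map (\<lambda>r. (1::nat, rounds, ow r)) [0..<rounds]"
  have alloc: "allocation_of_owners n m (ow r) = rotation n {1..m} (rk n) r" for r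
  proof -
    have "map (owner r) [0..<m] ! (g - 1) = owner r (g - 1)" if "g \<in> {1..m}" for g
      using that by (subst nth_map) auto
    then show ?thesis
      unfolding allocation_of_owners_def rotation_def ow_def
      by (intro restrict_ext) (auto simp: Suc_le_eq)
  qed
  have inj: "inj_on (rotation n {1..m} (rk n)) {..<rounds}"
  proof (cases "m = 0")
    case True
    show ?thesis unfolding rounds_eq(1)[OF True] by (simp add: inj_on_def)
  next
    case False
    then show ?thesis unfolding rounds_eq(2)[OF False] by (intro inj_on_rotation) simp
  qed
  have "rotation n {1..m} (rk n) ` {..<rounds} = rotation n {1..m} (rk n) ` {..<n}"
  proof (cases "m = 0")
    case True
    have "rotation n {1..m} (rk n) = (\<lambda>r. \<lambda>i\<in>{1..n}. {})"
      using True by (simp add: rotation_def fun_eq_iff)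
    moreover have "{..<rounds} \<noteq> {}" "{..<n} \<noteq> {}"
      using n_pos unfolding rounds_def by (simp_all add: lessThan_empty_iff)
    ultimately show ?thesis by (simp only: image_constant_conv if_False)
  next
    case False
    show ?thesis unfolding rounds_eq(2)[OF False] ..
  qed
  then have supp: "rotation n {1..m} (rk n) ` {..<rounds} = set_pmf (rotation_pmf n {1..m} (rk n))"
    by (simp only: set_rotation_pmf[OF n_pos])
  have prob: "pmf (rotation_pmf n {1..m} (rk n)) (rotation n {1..m} (rk n) r) = 1 / real rounds"
    if "r < rounds" for r
  proof (cases "m = 0")
    case True
    then show ?thesis
      using pmf_rotation_pmf_empty[OF n_pos] unfolding rounds_eq(1)[OF True] by simp
  next
    case False
    then show ?thesis using that unfolding rounds_eq(2)[OF False]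
      by (intro pmf_rotation_pmf) simp_all
  qed
  \<comment> \<open>Owner lists determine allocations, and the allocations of different rounds
    differ.\<close>
  have "inj_on ow {..<rounds}"
    using inj alloc by (metis inj_on_def)
  then have "distinct (map (\<lambda>(a, b, ow). ow) L)"
    by (simp add: L_def comp_def distinct_map atLeast0LessThan)
  moreover have "written rounds = concat (map (\<lambda>(a, b, ow). a # b # ow) L)"
    by (simp add: written_def L_def ow_def comp_def)
  moreover have "length (ow r) = m" "set (ow r) \<subseteq> {1..n}" for r
    using n_pos by (auto simp: ow_def Suc_le_eq)
  moreover have "0 < rounds"
    using n_pos by (simp add: rounds_def)
  moreover have "(\<lambda>(a, b, ow). allocation_of_owners n m ow) ` set L =
      set_pmf (rotation_pmf n {1..m} (rk n))"
    unfolding supp[symmetric] by (simp add: L_def image_image alloc atLeast0LessThan)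
  moreover note prob
  ultimately show ?thesis
    unfolding encodes_distribution_def
    by (intro exI[of _ L] conjI) (simp_all add: L_def alloc)
qed

end

theorem theorem9:
  shows
    "(\<forall>(n::nat) (M::'a set) (v :: nat \<Rightarrow> 'a set \<Rightarrow> real).
        fair_division_instance n M v \<and> binary_goods n M v \<and> normalized n M v \<and>
        laminar_approvals n M v \<longrightarrow>
        (\<exists>D. randomized_allocation n M D \<and> ex_ante_EF n v D \<and> ex_ante_EQ n v D \<and>
             ex_post (EF1 n v) D \<and> ex_post (EQ1 n v) D))
     \<and>
     poly_time_solvable
       {(n, m, v :: nat \<Rightarrow> nat set \<Rightarrow> real).
          fair_division_instance n {1..m} v \<and> binary_goods n {1..m} v \<and>
          normalized n {1..m} v \<and> laminar_approvals n {1..m} v}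
       (\<lambda>(n, m, v). encode_instance n m v)
       (\<lambda>(n, m, v) w. \<exists>D. encodes_distribution n m w D \<and>
          randomized_allocation n {1..m} D \<and> ex_ante_EF n v D \<and> ex_ante_EQ n v D \<and>
          ex_post (EF1 n v) D \<and> ex_post (EQ1 n v) D)"
proof (intro conjI allI impI)
  fix n and M :: "'a set" and v :: "nat \<Rightarrow> 'a set \<Rightarrow> real"
  assume "fair_division_instance n M v \<and> binary_goods n M v \<and> normalized n M v \<and>
      laminar_approvals n M v"
  then interpret laminar_instance n M v by unfold_locales auto
  \<comment> \<open>Abstract items carry no order; an injection into the naturals supplies one for
    the ranks.\<close>
  obtain f :: "'a \<Rightarrow> nat" where "inj_on f M"
    using finite_imp_inj_to_nat_seg[OF finite_items] by blast
  then show "\<exists>D. randomized_allocation n M D \<and> ex_ante_EF n v D \<and> ex_ante_EQ n v D \<and>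
           ex_post (EF1 n v) D \<and> ex_post (EQ1 n v) D"
    using rotation_pmf_fair by blast
next
  show "poly_time_solvable
       {(n, m, v :: nat \<Rightarrow> nat set \<Rightarrow> real).
          fair_division_instance n {1..m} v \<and> binary_goods n {1..m} v \<and>
          normalized n {1..m} v \<and> laminar_approvals n {1..m} v}
       (\<lambda>(n, m, v). encode_instance n m v)
       (\<lambda>(n, m, v) w. \<exists>D. encodes_distribution n m w D \<and>
          randomized_allocation n {1..m} D \<and> ex_ante_EF n v D \<and> ex_ante_EQ n v D \<and>
          ex_post (EF1 n v) D \<and> ex_post (EQ1 n v) D)"
    unfolding poly_time_solvable_def
  proof (intro exI[of _ fair_prog] exI[of _ "[:0, 300:]"] ballI, clarify)
    fix n m and v :: "nat \<Rightarrow> nat set \<Rightarrow> real"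
    assume "fair_division_instance n {1..m} v" "binary_goods n {1..m} v"
      "normalized n {1..m} v" "laminar_approvals n {1..m} v"
    then interpret encoded_instance n m v by unfold_locales
    obtain t s where "exec fair_prog (initial_state input) t s" "t \<le> 300 * length input"
      "outp s = written rounds"
      using fair_prog unfolding triple_def by blast
    \<comment> \<open>Here the items are numbers and the identity serves as the order, matching the
      left-to-right scan of each row.\<close>
    moreover note encodes_written rotation_pmf_fair[OF inj_on_id[of "{1..m}"]]
    ultimately show "\<exists>t s. exec fair_prog (initial_state input) t s \<and>
        t \<le> poly [:0, 300:] (length input) \<and>
        (\<exists>D. encodes_distribution n m (outp s) D \<and> randomized_allocation n {1..m} D \<and>
          ex_ante_EF n v D \<and> ex_ante_EQ n v D \<and> ex_post (EF1 n v) D \<and> ex_post (EQ1 n v) D)"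
      by (intro exI[of _ t] exI[of _ s] conjI exI[of _ "rotation_pmf n {1..m} (rk n)"])
        (simp_all only: poly_pCons poly_0 mult_zero_right add_0 add_0_right mult.commute[of _ 300])
  qed
qed

end
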